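(* Let $T$ and $T'$ be two pointed dyadic triangles in $\mathbb{D}^2$, each with clockwise ordered vertices. Then $T$ and $T'$ are isomorphic (by an isomorphism preserving the pointed vertex and the orientation of vertices) if and only if they have the same encoding triples, i.e. for every encoding triple $(i,j,m)$ one has $T_{i,j,m}\in\mathcal{R}(T)$ if and only if $T_{i,j,m}\in\mathcal{R}(T')$.
   Context: $\mathbb{D}=\mathbb{Z}[1/2]$ is the ring of dyadic rationals. A dyadic triangle is the intersection with $\mathbb{D}^2$ of a non-degenerate closed real triangle in $\mathbb{R}^2$ whose three vertices lie in $\mathbb{D}^2$. It is regarded as an algebra (groupoid) under the operation $x\circ y=\tfrac12(x+y)$. An isomorphism of dyadic triangles is a bijection preserving $\circ$; such isomorphisms are taken to be the restrictions of automorphisms of the affine $\mathbb{D}$-space $\mathbb{D}^2$, i.e. of maps $x\mapsto xM+t$ (row vectors) with $M\in \mathrm{GL}(2,\mathbb{D})$ (so $\det M=\pm2^k$ for some $k\in\mathbb{Z}$) and $t\in\mathbb{D}^2$. Such an isomorphism preserves the orientation of vertices when $\det M>0$. A pointed dyadic triangle is a dyadic triangle with a chosen (pointed) vertex; its vertices are listed in clockwise order $A,B,C$ with $A$ the pointed vertex. A pointed (oriented) isomorphism between pointed dyadic triangles is an isomorphism that maps the pointed vertex to the pointed vertex and preserves the orientation of vertices. For an odd integer $i$ and positive odd integers $j,m$, the representative hat $T_{i,j,m}$ is the dyadic triangle with vertices $A=(0,0)$, $B=(i,j)$, $C=(m,0)$, pointed at $A=(0,0)$. For a pointed dyadic triangle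 $T$, $\mathcal{R}(T)$ is the class of all representative hats pointed isomorphic to $T$. An encoding triple is a triple $(i,j,m)$ of odd integers with $j,m>0$ and $i\in\{1,3,\dots,2j-1\}$; it is an encoding triple of $T$ when $T_{i,j,m}\in\mathcal{R}(T)$. *)

theory Defs
  imports "HOL-Analysis.Analysis"
begin

definition dyadic_rationals :: "real set" where
  "dyadic_rationals = {of_int a / 2 ^ n | (a::int) (n::nat). True}"

definition dyadic_plane :: "(real^2) set" where
  "dyadic_plane = {x. \<forall>k. x $ k \<in> dyadic_rationals}"

definition GL2_dyadic :: "(real^2^2) set" where
  "GL2_dyadic = {M. (\<forall>k. row k M \<in> dyadic_plane) \<and>
     (\<exists>N. (\<forall>k. row k N \<in> dyadic_plane) \<and> M ** N = mat 1 \<and> N ** M = mat 1)}"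

text \<open>
  A pointed triangle is given by its vertices listed in clockwise order, starting with the pointed
  vertex. This list is determined by the underlying point set and the pointed vertex.
\<close>

datatype pointed_triangle =
  Pointed_Triangle (vertex_A: "real^2") (vertex_B: "real^2") (vertex_C: "real^2")

definition points :: "pointed_triangle \<Rightarrow> (real^2) set" where
  "points T = convex hull {vertex_A T, vertex_B T, vertex_C T} \<inter> dyadic_plane"

text \<open>The determinant below is twice the signed area of \<open>ABC\<close>, positive for counterclockwise order.\<close>

definition clockwise :: "real^2 \<Rightarrow> real^2 \<Rightarrow> real^2 \<Rightarrow> bool" where
  "clockwise A B C \<longleftrightarrow> det (vector [B - A, C - A] :: real^2^2) < 0"

definition pointed_dyadic_triangle :: "pointed_triangle \<Rightarrow> bool" where
  "pointed_dyadic_triangle T \<longleftrightarrow>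
     {vertex_A T, vertex_B T, vertex_C T} \<subseteq> dyadic_plane \<and>
     \<not> collinear {vertex_A T, vertex_B T, vertex_C T} \<and>
     clockwise (vertex_A T) (vertex_B T) (vertex_C T)"

definition induced_by :: "(real^2 \<Rightarrow> real^2) \<Rightarrow> (real^2) set \<Rightarrow> real^2^2 \<Rightarrow> real^2 \<Rightarrow> bool" where
  "induced_by f S M t \<longleftrightarrow>
     M \<in> GL2_dyadic \<and> t \<in> dyadic_plane \<and> (\<forall>x\<in>S. f x = x v* M + t)"

text \<open>The groupoid operation \<open>(x + y) / 2\<close> is the library's \<^const>\<open>midpoint\<close>.\<close>

definition dyadic_triangle_iso ::
    "(real^2 \<Rightarrow> real^2) \<Rightarrow> (real^2) set \<Rightarrow> (real^2) set \<Rightarrow> bool" where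
  "dyadic_triangle_iso f S S' \<longleftrightarrow>
     bij_betw f S S' \<and>
     (\<forall>x\<in>S. \<forall>y\<in>S. f (midpoint x y) = midpoint (f x) (f y)) \<and>
     (\<exists>M t. induced_by f S M t)"

text \<open>A non-degenerate \<open>S\<close> spans the plane, so \<open>M\<close> is determined by \<open>f\<close> on \<open>S\<close>.\<close>

definition orientation_preserving_on :: "(real^2) set \<Rightarrow> (real^2 \<Rightarrow> real^2) \<Rightarrow> bool" where
  "orientation_preserving_on S f \<longleftrightarrow> (\<exists>M t. induced_by f S M t \<and> det M > 0)"

definition pointed_isomorphic :: "pointed_triangle \<Rightarrow> pointed_triangle \<Rightarrow> bool" where
  "pointed_isomorphic T T' \<longleftrightarrow>
     (\<exists>f. dyadic_triangle_iso f (points T) (points T') \<and>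
          f (vertex_A T) = vertex_A T' \<and>
          orientation_preserving_on (points T) f)"

definition hat :: "int \<Rightarrow> int \<Rightarrow> int \<Rightarrow> pointed_triangle" where
  "hat i j m = Pointed_Triangle (vector [0, 0]) (vector [of_int i, of_int j]) (vector [of_int m, 0])"

definition representative_hats :: "pointed_triangle set" where
  "representative_hats = {hat i j m | i j m. odd i \<and> odd j \<and> odd m \<and> j > 0 \<and> m > 0}"

definition hats_of :: "pointed_triangle \<Rightarrow> pointed_triangle set" where
  "hats_of T = {H \<in> representative_hats. pointed_isomorphic H T}"

definition encoding_triple :: "int \<Rightarrow> int \<Rightarrow> int \<Rightarrow> bool" where
  "encoding_triple i j m \<longleftrightarrow>
     odd i \<and> odd j \<and> odd m \<and> j > 0 \<and> m > 0 \<and> 1 \<le> i \<and> i \<le> 2 * j - 1"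

end

theory Submission
  imports Defs "HOL-Number_Theory.Cong"
begin

text \<open>
  Pointed isomorphism is an equivalence relation, so everything rests on the fact that every
  pointed dyadic triangle \<open>ABC\<close> has an encoding triple. Put \<open>b = B - A\<close> and \<open>c = C - A\<close>. Pulling the
  odd part \<open>m\<close> of the content out of \<open>c\<close> leaves \<open>c = m u\<close> with \<open>u\<close> a power of two times a primitive
  integer vector, and a complement \<open>v\<close> of \<open>u\<close> can be scaled by a power of two so that
  \<open>b = x u + j v\<close> with \<open>j\<close> odd and positive. Replacing \<open>v\<close> by \<open>v + s u\<close> changes \<open>x\<close> by multiples of \<open>j\<close>
  in the dyadic rationals; since \<open>2\<close> is invertible modulo \<open>j\<close>, this turns \<open>x\<close> into an integer, which
  can be taken odd and reduced modulo \<open>2j\<close>.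
\<close>

subsection \<open>Dyadic rationals\<close>

lemma dyadic_divide_power: "of_int a / 2 ^ n \<in> dyadic_rationals"
  unfolding dyadic_rationals_def by blast

lemma dyadic_of_int: "of_int a \<in> dyadic_rationals"
  using dyadic_divide_power[of a 0] by simp

lemma dyadic_add:
  assumes "x \<in> dyadic_rationals" "y \<in> dyadic_rationals"
  shows "x + y \<in> dyadic_rationals"
proof -
  obtain a n b k where x: "x = of_int a / 2 ^ n" and y: "y = of_int b / 2 ^ k"
    using assms unfolding dyadic_rationals_def by blast
  have "x + y = of_int (a * 2 ^ k + b * 2 ^ n) / 2 ^ (n + k)"
    unfolding x y by (simp add: field_simps power_add)
  then show ?thesis by (metis dyadic_divide_power)
qed

lemma dyadic_mult:
  assumes "x \<in> dyadic_rationals" "y \<in> dyadic_rationals"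
  shows "x * y \<in> dyadic_rationals"
proof -
  obtain a n b k where x: "x = of_int a / 2 ^ n" and y: "y = of_int b / 2 ^ k"
    using assms unfolding dyadic_rationals_def by blast
  have "x * y = of_int (a * b) / 2 ^ (n + k)"
    unfolding x y by (simp add: power_add)
  then show ?thesis by (metis dyadic_divide_power)
qed

lemma dyadic_uminus: "x \<in> dyadic_rationals \<Longrightarrow> - x \<in> dyadic_rationals"
  using dyadic_mult[OF dyadic_of_int[of "-1"]] by simp

lemma dyadic_diff: "x \<in> dyadic_rationals \<Longrightarrow> y \<in> dyadic_rationals \<Longrightarrow> x - y \<in> dyadic_rationals"
  using dyadic_add[OF _ dyadic_uminus] by fastforce

lemma dyadic_powi: "2 powi k \<in> dyadic_rationals"
proof (cases "k \<ge> 0")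
  case True
  then have "(2::real) powi k = of_int (2 ^ nat k)" by (simp add: power_int_def)
  then show ?thesis by (metis dyadic_of_int)
next
  case False
  then have "(2::real) powi k = of_int 1 / 2 ^ nat (- k)"
    by (simp add: power_int_def inverse_eq_divide power_divide)
  then show ?thesis by (metis dyadic_divide_power)
qed

lemmas dyadic_closed = dyadic_of_int dyadic_add dyadic_mult dyadic_uminus dyadic_diff dyadic_powi

text \<open>The powers of two in numerator and denominator merge into one power with an integer
  exponent, which is a unit of the ring. Thus \<open>j\<close> is the part of \<open>y\<close> that
  survives up to units.\<close>

lemma dyadic_pos_decompose:
  assumes "y \<in> dyadic_rationals" "y > 0"
  obtains j k :: int where "odd j" "j > 0" "y = of_int j * 2 powi k"
proof -
  obtain a n where y: "y = of_int a / 2 ^ n"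
    using assms unfolding dyadic_rationals_def by blast
  have "a > 0" using assms(2) y by (simp add: zero_less_divide_iff)
  obtain j where j: "a = 2 ^ multiplicity 2 a * j" "\<not> 2 dvd j"
    using multiplicity_decompose'[of a 2] \<open>a > 0\<close> by auto
  define l where "l = multiplicity 2 a"
  have "j > 0" using \<open>a > 0\<close> j(1) by (metis zero_less_mult_pos zero_less_numeral zero_less_power)
  have "(2::real) powi (int l - int n) = 2 ^ l / 2 ^ n" by (simp add: power_int_diff)
  then have "y = of_int j * 2 powi (int l - int n)"
    unfolding y by (subst j(1)) (simp add: l_def)
  then show thesis using that j(2) \<open>j > 0\<close> by blast
qed

text \<open>Since 2 is invertible modulo the odd number \<open>j\<close>, every dyadic rational is
  congruent to an integer modulo \<open>j\<close> times the ring. Each residue class modulo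
  \<open>j\<close> contains exactly one odd number between 1 and \<open>2 * j - 1\<close>.\<close>

lemma dyadic_odd_residue:
  fixes j :: int
  assumes "x \<in> dyadic_rationals" "odd j" "j > 0"
  obtains i s where "odd i" "1 \<le> i" "i \<le> 2 * j - 1" "s \<in> dyadic_rationals"
    "x = of_int i + of_int j * s"
proof -
  obtain a h where x: "x = of_int a / 2 ^ h"
    using assms unfolding dyadic_rationals_def by blast
  have "coprime (2 ^ h) j" using assms(2) by simp
  \<comment> \<open>\<open>y\<close> inverts \<open>2 ^ h\<close> modulo \<open>j\<close>, so
    \<open>y * a\<close> is an integer in the residue class of \<open>x\<close>.\<close>
  then obtain y where "[2 ^ h * y = 1] (mod j)" using cong_solve_coprime_int by blast
  then have "[2 ^ h * y * a = 1 * a] (mod j)" by (rule cong_scalar_right)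
  then have "[2 ^ h * (y * a) = a] (mod j)" by (simp add: mult.assoc)
  then have "j dvd a - 2 ^ h * (y * a)" by (metis cong_iff_dvd_diff cong_sym)
  then obtain z where z: "a = 2 ^ h * (y * a) + j * z" by (metis add.commute diff_add_cancel dvdE)
  \<comment> \<open>Adding the odd number \<open>j\<close> flips the parity and keeps the residue
    modulo \<open>j\<close>. Reducing modulo \<open>2 * j\<close> instead of \<open>j\<close> then
    preserves the parity.\<close>
  define w where "w = (if odd (y * a) then y * a else y * a + j)"
  define i where "i = w mod (2 * j)"
  have w: "odd w" unfolding w_def using assms(2) by simp
  have i: "w = i + j * (2 * (w div (2 * j)))"
    unfolding i_def by (metis add.commute mult.assoc mult.commute mult_div_mod_eq)
  then have "odd i" using w by (metis dvd_add dvd_mult dvd_triv_left)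
  moreover have "0 \<le> i" "i < 2 * j" using assms(3) by (simp_all add: i_def)
  \<comment> \<open>The remainder 0 is excluded by oddness, which raises the lower bound to
    1.\<close>
  moreover have "i \<noteq> 0" using \<open>odd i\<close> by auto
  moreover obtain t where t: "y * a = i + j * t"
  proof (cases "odd (y * a)")
    case True
    then show ?thesis using that i w_def by metis
  next
    case False
    then have "y * a = i + j * (2 * (w div (2 * j)) - 1)"
      using i by (simp add: w_def algebra_simps)
    then show ?thesis using that by blast
  qed
  moreover have "x = of_int i + of_int j * (of_int t + of_int z / 2 ^ h)"
  proof -
    have "real_of_int a = 2 ^ h * (of_int i + of_int j * of_int t) + of_int j * of_int z"
      using z unfolding t by (metis of_int_add of_int_mult of_int_numeral of_int_power)
    then show ?thesis unfolding x by (simp add: field_simps)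
  qed
  ultimately show thesis
    using that[of i "of_int t + of_int z / 2 ^ h"] dyadic_add dyadic_of_int dyadic_divide_power
    by force
qed

subsection \<open>Affine maps over the dyadic rationals\<close>

lemma dyadic_plane_iff:
  "x \<in> dyadic_plane \<longleftrightarrow> x $ 1 \<in> dyadic_rationals \<and> x $ 2 \<in> dyadic_rationals"
  unfolding dyadic_plane_def by (simp add: forall_2)

lemma dyadic_plane_add: "x \<in> dyadic_plane \<Longrightarrow> y \<in> dyadic_plane \<Longrightarrow> x + y \<in> dyadic_plane"
  by (simp add: dyadic_plane_iff dyadic_closed)

lemma dyadic_plane_diff: "x \<in> dyadic_plane \<Longrightarrow> y \<in> dyadic_plane \<Longrightarrow> x - y \<in> dyadic_plane"
  by (simp add: dyadic_plane_iff dyadic_closed)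

lemma dyadic_plane_uminus: "x \<in> dyadic_plane \<Longrightarrow> - x \<in> dyadic_plane"
  by (simp add: dyadic_plane_iff dyadic_closed)

lemma dyadic_plane_scaleR:
  "a \<in> dyadic_rationals \<Longrightarrow> x \<in> dyadic_plane \<Longrightarrow> a *\<^sub>R x \<in> dyadic_plane"
  by (simp add: dyadic_plane_iff dyadic_closed)

lemma dyadic_plane_vector_matrix_mult:
  fixes M :: "real^2^2"
  assumes "x \<in> dyadic_plane" "\<forall>k. row k M \<in> dyadic_plane"
  shows "x v* M \<in> dyadic_plane"
  using assms
  by (simp add: dyadic_plane_iff row_def vector_matrix_mult_def sum_2 forall_2 dyadic_closed)

text \<open>In the row convention \<open>N\<close> acts on each row of \<open>M\<close> separately;
  this reduces closure of dyadic matrices under products to the action on vectors.\<close>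

lemma row_matrix_matrix_mult: "row k (M ** N) = row k M v* N"
  for M N :: "real^2^2"
  by (simp add: vec_eq_iff row_def matrix_matrix_mult_def vector_matrix_mult_def mult.commute)

lemma GL2_dyadic_rows: "M \<in> GL2_dyadic \<Longrightarrow> row k M \<in> dyadic_plane"
  by (simp add: GL2_dyadic_def)

lemma GL2_dyadic_mult:
  assumes "M \<in> GL2_dyadic" "N \<in> GL2_dyadic"
  shows "M ** N \<in> GL2_dyadic"
proof -
  obtain M' N' where *: "\<forall>k. row k M' \<in> dyadic_plane" "M ** M' = mat 1" "M' ** M = mat 1"
    "\<forall>k. row k N' \<in> dyadic_plane" "N ** N' = mat 1" "N' ** N = mat 1"
    using assms unfolding GL2_dyadic_def by blast
  have rows: "\<forall>k. row k (M ** N) \<in> dyadic_plane" "\<forall>k. row k (N' ** M') \<in> dyadic_plane"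
    using assms * by (auto simp: row_matrix_matrix_mult GL2_dyadic_rows
        intro!: dyadic_plane_vector_matrix_mult)
  have "(M ** N) ** (N' ** M') = mat 1" "(N' ** M') ** (M ** N) = mat 1"
    using * by (metis matrix_mul_assoc matrix_mul_rid)+
  then show ?thesis using rows unfolding GL2_dyadic_def by blast
qed

lemma GL2_dyadic_inverse:
  assumes "M \<in> GL2_dyadic"
  obtains N where "N \<in> GL2_dyadic" "M ** N = mat 1" "N ** M = mat 1"
  using assms unfolding GL2_dyadic_def by blast

text \<open>The adjugate has dyadic entries, so the inverse matrix does as soon as the inverse of
  the determinant is dyadic. Because \<open>inverse 0 = 0\<close> is dyadic, a nonzero determinant
  is a separate condition.\<close>

lemma GL2_dyadicI:
  fixes M :: "real^2^2"
  assumes rows: "\<forall>k. row k M \<in> dyadic_plane"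
    and det: "det M \<noteq> 0" "inverse (det M) \<in> dyadic_rationals"
  shows "M \<in> GL2_dyadic"
proof -
  define N :: "real^2^2" where
    "N = inverse (det M) *\<^sub>R vector [vector [M$2$2, - (M$1$2)], vector [- (M$2$1), M$1$1]]"
  have D: "M$k$l \<in> dyadic_rationals" for k l
    using rows by (simp add: dyadic_plane_def row_def)
  have "\<forall>k. row k N \<in> dyadic_plane"
    by (simp add: N_def forall_2 dyadic_plane_iff row_def dyadic_closed D det)
  moreover have "M ** N = mat 1" "N ** M = mat 1"
    using det(1)
    by (simp_all add: vec_eq_iff forall_2 matrix_matrix_mult_def sum_2 mat_def N_def det_2
        divide_simps)
  ultimately show ?thesis using rows unfolding GL2_dyadic_def by blast
qed

section \<open>Pointed isomorphisms as affine maps, and their equivalence relation\<close>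

lemma vertex_A_in_points:
  assumes "{vertex_A T, vertex_B T, vertex_C T} \<subseteq> dyadic_plane"
  shows "vertex_A T \<in> points T"
  using assms unfolding points_def by (simp add: hull_inc)

lemma midpoint_affine: "midpoint x y v* M + t = midpoint (x v* M + t) (y v* M + t)"
  for M :: "real^2^2"
  by (simp add: vec_eq_iff midpoint_def vector_matrix_mult_def sum_2 forall_2 field_simps)

text \<open>On the points of \<open>T\<close> the bijection agrees with an affine map and may be
  replaced by it; conversely, affine maps preserve midpoints. Membership of the vertex lets its
  image be computed by the affine formula.\<close>

lemma pointed_isomorphic_iff:
  assumes "vertex_A T \<in> points T"
  shows "pointed_isomorphic T T' \<longleftrightarrow>
    (\<exists>M t. M \<in> GL2_dyadic \<and> t \<in> dyadic_plane \<and> det M > 0 \<and>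
       bij_betw (\<lambda>x. x v* M + t) (points T) (points T') \<and> vertex_A T v* M + t = vertex_A T')"
    (is "_ \<longleftrightarrow> ?R")
proof
  assume "pointed_isomorphic T T'"
  \<comment> \<open>The pair \<open>M\<close>, \<open>t\<close> is the one provided by
    \<open>orientation_preserving_on\<close>, so the determinant is known to be positive.\<close>
  then obtain f M t where f: "bij_betw f (points T) (points T')" "f (vertex_A T) = vertex_A T'"
      and M: "induced_by f (points T) M t" "det M > 0"
    unfolding pointed_isomorphic_def dyadic_triangle_iso_def orientation_preserving_on_def by blast
  from M have *: "f x = x v* M + t" if "x \<in> points T" for x
    using that by (simp add: induced_by_def)
  have "bij_betw (\<lambda>x. x v* M + t) (points T) (points T')"
    by (rule iffD1[OF bij_betw_cong f(1)]) (rule *)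
  then show ?R using M f(2) * assms unfolding induced_by_def by metis
next
  assume ?R
  then obtain M t where *: "M \<in> GL2_dyadic" "t \<in> dyadic_plane" "det M > 0"
    "bij_betw (\<lambda>x. x v* M + t) (points T) (points T')" "vertex_A T v* M + t = vertex_A T'"
    by blast
  then have "induced_by (\<lambda>x. x v* M + t) (points T) M t" by (simp add: induced_by_def)
  then show "pointed_isomorphic T T'"
    unfolding pointed_isomorphic_def dyadic_triangle_iso_def orientation_preserving_on_def
    using * midpoint_affine by blast
qed

lemma pointed_isomorphic_trans:
  assumes "vertex_A T \<in> points T" "vertex_A T' \<in> points T'"
    and "pointed_isomorphic T T'" "pointed_isomorphic T' T''"
  shows "pointed_isomorphic T T''"
proof -
  obtain M t where M: "M \<in> GL2_dyadic" "t \<in> dyadic_plane" "det M > 0"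
    "bij_betw (\<lambda>x. x v* M + t) (points T) (points T')" "vertex_A T v* M + t = vertex_A T'"
    using assms pointed_isomorphic_iff by blast
  obtain N s where N: "N \<in> GL2_dyadic" "s \<in> dyadic_plane" "det N > 0"
    "bij_betw (\<lambda>x. x v* N + s) (points T') (points T'')" "vertex_A T' v* N + s = vertex_A T''"
    using assms pointed_isomorphic_iff by blast
  have eq: "(x v* M + t) v* N + s = x v* (M ** N) + (t v* N + s)" for x
    by (simp add: vector_matrix_left_distrib vector_matrix_mul_assoc)
  have "bij_betw (\<lambda>x. x v* (M ** N) + (t v* N + s)) (points T) (points T'')"
    using bij_betw_trans[OF M(4) N(4)] by (simp add: o_def eq)
  moreover have "vertex_A T v* (M ** N) + (t v* N + s) = vertex_A T''"
    using eq M(5) N(5) by metis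
  moreover have "t v* N + s \<in> dyadic_plane"
    using M N by (simp add: dyadic_plane_add dyadic_plane_vector_matrix_mult GL2_dyadic_rows)
  moreover have "det (M ** N) > 0" using M N by (simp add: det_mul)
  ultimately show ?thesis
    using pointed_isomorphic_iff[OF assms(1)] GL2_dyadic_mult[OF M(1) N(1)] by blast
qed

lemma pointed_isomorphic_sym:
  assumes "vertex_A T \<in> points T" "vertex_A T' \<in> points T'"
    and "pointed_isomorphic T T'"
  shows "pointed_isomorphic T' T"
proof -
  obtain M t where M: "M \<in> GL2_dyadic" "t \<in> dyadic_plane" "det M > 0"
    "bij_betw (\<lambda>x. x v* M + t) (points T) (points T')" "vertex_A T v* M + t = vertex_A T'"
    using assms pointed_isomorphic_iff by blast
  obtain N where N: "N \<in> GL2_dyadic" "M ** N = mat 1" "N ** M = mat 1"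
    using GL2_dyadic_inverse M(1) by blast
  \<comment> \<open>\<open>?g\<close> is the inverse of \<open>?f\<close>, with its offset split off
    to fit the shape \<open>x v* M + t\<close>.\<close>
  let ?f = "\<lambda>x. x v* M + t" and ?g = "\<lambda>y. y v* N + (- t) v* N"
  have g: "?g y = (y - t) v* N" for y
    by (simp flip: vector_matrix_left_distrib)
  have left: "?g (?f x) = x" for x
    unfolding g by (simp add: vector_matrix_mul_assoc N)
  have right: "?f (?g y) = y" for y
    unfolding g by (simp add: vector_matrix_mul_assoc N)
  have img: "?f ` points T = points T'" using M(4) by (rule bij_betw_imp_surj_on)
  have "?g ` points T' = points T"
    unfolding img[symmetric] image_image left by simp
  then have "bij_betw ?g (points T') (points T)"
    using img left right by (intro bij_betw_byWitness[where f' = ?f]) blast+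
  moreover have "?g (vertex_A T') = vertex_A T" using left[of "vertex_A T"] unfolding M(5) .
  moreover have "(- t) v* N \<in> dyadic_plane"
    using M N by (simp add: dyadic_plane_uminus dyadic_plane_vector_matrix_mult GL2_dyadic_rows)
  moreover have "det M * det N = 1" using N(2) by (metis det_I det_mul)
  then have "det N > 0" using M(3) by (metis zero_less_mult_pos zero_less_one)
  ultimately show ?thesis
    using pointed_isomorphic_iff[OF assms(2)] N(1) by blast
qed

text \<open>Checking the vertices suffices: an affine map commutes with convex hulls, an invertible
  dyadic one maps the dyadic plane onto itself, and injectivity carries the intersection of the two
  through the image.\<close>

lemma pointed_isomorphicI:
  assumes "{vertex_A T, vertex_B T, vertex_C T} \<subseteq> dyadic_plane"
    and M: "M \<in> GL2_dyadic" "t \<in> dyadic_plane" "det M > 0"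
    and v: "vertex_A T v* M + t = vertex_A T'" "vertex_B T v* M + t = vertex_B T'"
      "vertex_C T v* M + t = vertex_C T'"
  shows "pointed_isomorphic T T'"
proof -
  let ?f = "\<lambda>x. x v* M + t"
  obtain N where N: "N \<in> GL2_dyadic" "M ** N = mat 1" "N ** M = mat 1"
    using GL2_dyadic_inverse M(1) by blast
  have left: "(?f x - t) v* N = x" for x
    by (simp add: vector_matrix_mul_assoc N)
  have right: "?f ((y - t) v* N) = y" for y
    by (simp add: vector_matrix_mul_assoc N)
  have lin: "linear (\<lambda>x. x v* M)"
    by (rule linearI) (simp_all add: vector_matrix_left_distrib scaleR_vector_matrix_assoc)
  have "?f ` (convex hull S) = convex hull (?f ` S)" for S
  proof -
    have "?f ` (convex hull S) = (\<lambda>x. t + x) ` ((\<lambda>x. x v* M) ` (convex hull S))"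
      by (simp add: image_image add.commute)
    also have "\<dots> = convex hull ((\<lambda>x. t + x) ` ((\<lambda>x. x v* M) ` S))"
      using convex_hull_linear_image[OF lin] convex_hull_translation by metis
    also have "\<dots> = convex hull (?f ` S)"
      by (simp add: image_image add.commute)
    finally show ?thesis .
  qed
  then have hull: "?f ` (convex hull {vertex_A T, vertex_B T, vertex_C T})
      = convex hull {vertex_A T', vertex_B T', vertex_C T'}"
    using v by simp
  have plane: "?f ` dyadic_plane = dyadic_plane"
  proof
    show "?f ` dyadic_plane \<subseteq> dyadic_plane"
      using M by (auto intro!: dyadic_plane_add dyadic_plane_vector_matrix_mult
          simp: GL2_dyadic_rows)
    show "dyadic_plane \<subseteq> ?f ` dyadic_plane"
    proof
      fix y assume "y \<in> dyadic_plane"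
      then have "(y - t) v* N \<in> dyadic_plane"
        using M N by (simp add: dyadic_plane_diff dyadic_plane_vector_matrix_mult GL2_dyadic_rows)
      then show "y \<in> ?f ` dyadic_plane" using right by (metis image_eqI)
    qed
  qed
  have inj: "inj_on ?f S" for S
    by (rule inj_on_inverseI[where g = "\<lambda>y. (y - t) v* N"]) (rule left)
  have "bij_betw ?f (points T) (points T')"
    unfolding bij_betw_def points_def image_Int[OF inj] hull plane using inj by blast
  then show ?thesis
    using pointed_isomorphic_iff[OF vertex_A_in_points[OF assms(1)]] M v(1) by blast
qed

subsection \<open>Existence of encoding triples\<close>

text \<open>\<open>u\<close> and \<open>v\<close> are the rows of the matrix sought: it sends
  \<open>(i, j)\<close> to \<open>b\<close> and \<open>(m, 0)\<close> to \<open>c\<close>. Its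
  determinant is a power of two, hence a positive unit.\<close>

lemma clockwise_dyadic_basis:
  assumes b: "b \<in> dyadic_plane" and c: "c \<in> dyadic_plane"
    and neg: "b$1 * c$2 - b$2 * c$1 < 0"
  obtains i j m u v where "encoding_triple i j m"
    "u \<in> dyadic_plane" "v \<in> dyadic_plane"
    "u$1 * v$2 - u$2 * v$1 > 0" "inverse (u$1 * v$2 - u$2 * v$1) \<in> dyadic_rationals"
    "b = of_int i *\<^sub>R u + of_int j *\<^sub>R v" "c = of_int m *\<^sub>R u"
proof -
  obtain a1 n1 a2 n2 where a: "c$1 = of_int a1 / 2 ^ n1" "c$2 = of_int a2 / 2 ^ n2"
    using c unfolding dyadic_plane_iff dyadic_rationals_def by blast
  define c1 where "c1 = a1 * 2 ^ n2"
  define c2 where "c2 = a2 * 2 ^ n1"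
  define n where "n = n1 + n2"
  have c12: "c$1 = of_int c1 / 2 ^ n" "c$2 = of_int c2 / 2 ^ n"
    unfolding a c1_def c2_def n_def by (simp_all add: power_add)
  define g where "g = gcd c1 c2"
  have "c1 \<noteq> 0 \<or> c2 \<noteq> 0" using neg c12 by auto
  then have "g > 0" unfolding g_def by simp
  obtain p q where p: "c1 = g * p" and q: "c2 = g * q"
    unfolding g_def by (meson dvdE gcd_dvd1 gcd_dvd2)
  \<comment> \<open>The Bezout coefficients complete the primitive vector \<open>(p, q)\<close> by
    \<open>(-s', r')\<close> to a basis of determinant 1.\<close>
  obtain r' s' where "r' * c1 + s' * c2 = g" unfolding g_def by (metis bezout_int)
  then have "g * (r' * p + s' * q) = g * 1" using p q by (simp add: algebra_simps)
  then have bez: "r' * p + s' * q = 1" using \<open>g > 0\<close> by simp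
  define P Q r s where PQ: "P = real_of_int p" "Q = real_of_int q" "r = real_of_int r'"
    "s = real_of_int s'"
  have PQ1: "r * P + s * Q = 1"
    using arg_cong[OF bez, of real_of_int] by (simp add: PQ)
  have DPQ: "P \<in> dyadic_rationals" "Q \<in> dyadic_rationals" "r \<in> dyadic_rationals"
      "s \<in> dyadic_rationals" unfolding PQ by (simp_all add: dyadic_of_int)
  have "real_of_int g / 2 ^ n > 0" using \<open>g > 0\<close> by simp
  then obtain m k where m: "odd m" "m > 0" and k: "real_of_int g / 2 ^ n = of_int m * 2 powi k"
    using dyadic_pos_decompose[OF dyadic_divide_power] by blast
  have cP: "c$1 = of_int m * 2 powi k * P" "c$2 = of_int m * 2 powi k * Q"
    unfolding c12 k[symmetric] PQ by (simp_all add: p q)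
  \<comment> \<open>\<open>y\<close> is the coordinate of \<open>b\<close> along
    \<open>(-s, r)\<close> in the basis \<open>(P, Q)\<close>, \<open>(-s, r)\<close>. Clockwise
    order makes it positive.\<close>
  define y where "y = P * b$2 - Q * b$1"
  have bD: "b$1 \<in> dyadic_rationals" "b$2 \<in> dyadic_rationals" using b by (auto simp: dyadic_plane_iff)
  have "b$1 * c$2 - b$2 * c$1 = - (of_int m * 2 powi k * y)"
    unfolding cP y_def by (simp add: algebra_simps)
  then have "0 < (of_int m * 2 powi k) * y" using neg by simp
  moreover have "0 < real_of_int m * 2 powi k" using m by simp
  ultimately have "y > 0" by (rule zero_less_mult_pos)
  moreover have "y \<in> dyadic_rationals" unfolding y_def using DPQ bD by (simp add: dyadic_closed)
  ultimately obtain j l where j: "odd j" "j > 0" and l: "y = of_int j * 2 powi l"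
    using dyadic_pos_decompose by blast
  \<comment> \<open>This is the coordinate of \<open>b\<close> along \<open>(P, Q)\<close>, rescaled
    because \<open>u\<close> will be \<open>2 powi k\<close> times that vector.\<close>
  define x where "x = (r * b$1 + s * b$2) * 2 powi (- k)"
  have "x \<in> dyadic_rationals" unfolding x_def using DPQ bD by (simp add: dyadic_closed)
  then obtain i d where i: "odd i" "1 \<le> i" "i \<le> 2 * j - 1" and dD: "d \<in> dyadic_rationals"
    and xi: "x = of_int i + of_int j * d"
    using dyadic_odd_residue j by metis
  define e f where ef: "e = (2::real) powi k" "f = (2::real) powi l"
  have ef0: "e > 0" "f > 0" unfolding ef by simp_all
  have efD: "e \<in> dyadic_rationals" "f \<in> dyadic_rationals" unfolding ef by (simp_all add: dyadic_powi)
  define u :: "real^2" where "u = vector [e * P, e * Q]"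
  \<comment> \<open>\<open>v\<close> is \<open>d *\<^sub>R u\<close> plus \<open>f\<close> times
    \<open>(-s, r)\<close>. The shear by \<open>d\<close> absorbs the difference between
    \<open>x\<close> and the integer \<open>i\<close> and leaves the determinant unchanged.\<close>
  define v :: "real^2" where "v = vector [d * (e * P) - f * s, d * (e * Q) + f * r]"
  have det: "u$1 * v$2 - u$2 * v$1 = e * f"
  proof -
    have "u$1 * v$2 - u$2 * v$1 = e * f * (r * P + s * Q)"
      by (simp add: u_def v_def algebra_simps)
    then show ?thesis using PQ1 by simp
  qed
  have ix: "(of_int i + of_int j * d) * e = r * b$1 + s * b$2"
    unfolding xi[symmetric] x_def ef by (simp add: power_int_minus)
  have jf: "of_int j * f = P * b$2 - Q * b$1" using l by (simp add: y_def ef)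
  show thesis
  proof (rule that)
    show "encoding_triple i j m" using i j m by (simp add: encoding_triple_def)
    show "u \<in> dyadic_plane" "v \<in> dyadic_plane"
      using efD DPQ dD by (simp_all add: u_def v_def dyadic_plane_iff dyadic_closed)
    show "u$1 * v$2 - u$2 * v$1 > 0" using det ef0 by simp
    have "inverse (e * f) = 2 powi (- k) * 2 powi (- l)"
      by (simp add: ef power_int_minus)
    then show "inverse (u$1 * v$2 - u$2 * v$1) \<in> dyadic_rationals"
      using det by (metis dyadic_mult dyadic_powi)
    have "of_int i * (e * P) + of_int j * (d * (e * P) - f * s)
        = (of_int i + of_int j * d) * e * P - of_int j * f * s" by (simp add: algebra_simps)
    also have "\<dots> = (r * P + s * Q) * b$1"
      unfolding ix jf by (simp add: algebra_simps)
    finally have b1: "b$1 = of_int i * (e * P) + of_int j * (d * (e * P) - f * s)"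
      using PQ1 by simp
    have "of_int i * (e * Q) + of_int j * (d * (e * Q) + f * r)
        = (of_int i + of_int j * d) * e * Q + of_int j * f * r" by (simp add: algebra_simps)
    also have "\<dots> = (r * P + s * Q) * b$2"
      unfolding ix jf by (simp add: algebra_simps)
    finally have b2: "b$2 = of_int i * (e * Q) + of_int j * (d * (e * Q) + f * r)"
      using PQ1 by simp
    show "b = of_int i *\<^sub>R u + of_int j *\<^sub>R v"
      using b1 b2 by (simp add: vec_eq_iff forall_2 u_def v_def)
    show "c = of_int m *\<^sub>R u" using cP by (simp add: vec_eq_iff forall_2 u_def ef)
  qed
qed

section \<open>Encoding triples of a triangle, and comparison through a common hat\<close>

lemma hat_dyadic:
  "{vertex_A (hat i j m), vertex_B (hat i j m), vertex_C (hat i j m)} \<subseteq> dyadic_plane"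
  using dyadic_of_int[of 0] by (simp add: hat_def dyadic_plane_iff dyadic_of_int)

lemma encoding_triple_exists:
  assumes T: "pointed_dyadic_triangle T"
  obtains i j m where "encoding_triple i j m" "pointed_isomorphic (hat i j m) T"
proof -
  define A B C where ABC: "A = vertex_A T" "B = vertex_B T" "C = vertex_C T"
  have D: "A \<in> dyadic_plane" "B \<in> dyadic_plane" "C \<in> dyadic_plane" and cw: "clockwise A B C"
    using T unfolding pointed_dyadic_triangle_def ABC by auto
  have "(B - A)$1 * (C - A)$2 - (B - A)$2 * (C - A)$1 < 0"
    using cw by (simp add: clockwise_def det_2)
  then obtain i j m u v where ijm: "encoding_triple i j m"
    and uv: "u \<in> dyadic_plane" "v \<in> dyadic_plane"
    and det: "u$1 * v$2 - u$2 * v$1 > 0" "inverse (u$1 * v$2 - u$2 * v$1) \<in> dyadic_rationals"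
    and eq: "B - A = of_int i *\<^sub>R u + of_int j *\<^sub>R v" "C - A = of_int m *\<^sub>R u"
    using clockwise_dyadic_basis[of "B - A" "C - A"] D dyadic_plane_diff by metis
  \<comment> \<open>With rows \<open>u\<close> and \<open>v\<close>, followed by translation by
    \<open>A\<close>, the vertices of the hat go to \<open>A\<close>, \<open>B\<close>,
    \<open>C\<close> in order.\<close>
  define M :: "real^2^2" where "M = vector [u, v]"
  have dM: "det M = u$1 * v$2 - u$2 * v$1" by (simp add: M_def det_2)
  have "M \<in> GL2_dyadic"
    by (rule GL2_dyadicI) (use uv det dM in \<open>auto simp: forall_2 M_def row_def\<close>)
  moreover have "B = A + (B - A)" "C = A + (C - A)" by simp_all
  then have "B = of_int i *\<^sub>R u + of_int j *\<^sub>R v + A" "C = of_int m *\<^sub>R u + A"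
    unfolding eq by (simp_all add: add.commute)
  ultimately have "pointed_isomorphic (hat i j m) T"
    using D det dM
    by (intro pointed_isomorphicI[OF hat_dyadic, where M = M and t = A])
      (simp_all add: hat_def ABC[symmetric] M_def vec_eq_iff forall_2 vector_matrix_mult_def sum_2
        mult.commute)
  then show thesis using that ijm by blast
qed

theorem theorem5p7:
  fixes T T' :: pointed_triangle
  assumes "pointed_dyadic_triangle T" and "pointed_dyadic_triangle T'"
  shows "pointed_isomorphic T T' \<longleftrightarrow>
    (\<forall>i j m. encoding_triple i j m \<longrightarrow> (hat i j m \<in> hats_of T \<longleftrightarrow> hat i j m \<in> hats_of T'))"
proof -
  have A: "vertex_A T \<in> points T" "vertex_A T' \<in> points T'"
    using assms vertex_A_in_points unfolding pointed_dyadic_triangle_def by blast+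
  have H: "vertex_A (hat i j m) \<in> points (hat i j m)" for i j m
    using vertex_A_in_points hat_dyadic by blast
  \<comment> \<open>Every encoding triple yields a representative hat, so only the isomorphism
    condition of \<open>hats_of\<close> remains.\<close>
  have hats: "hat i j m \<in> hats_of S \<longleftrightarrow> pointed_isomorphic (hat i j m) S"
    if "encoding_triple i j m" for i j m S
    using that unfolding hats_of_def representative_hats_def encoding_triple_def by blast
  show ?thesis
  proof
    assume "pointed_isomorphic T T'"
    then show "\<forall>i j m. encoding_triple i j m \<longrightarrow>
        (hat i j m \<in> hats_of T \<longleftrightarrow> hat i j m \<in> hats_of T')"
      using hats A H pointed_isomorphic_trans pointed_isomorphic_sym by metis
  next
    assume same: "\<forall>i j m. encoding_triple i j m \<longrightarrow>
        (hat i j m \<in> hats_of T \<longleftrightarrow> hat i j m \<in> hats_of T')"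
    \<comment> \<open>One existing triple is enough: agreement transfers its hat to
      \<open>T'\<close>, and the two triangles are linked through it. Were there no triples at all,
      agreement would carry no information.\<close>
    obtain i j m where ijm: "encoding_triple i j m" "pointed_isomorphic (hat i j m) T"
      using encoding_triple_exists[OF assms(1)] .
    then have "pointed_isomorphic (hat i j m) T'" using same hats by blast
    then show "pointed_isomorphic T T'"
      using ijm(2) A H pointed_isomorphic_trans pointed_isomorphic_sym by metis
  qed
qed

end
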